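(* Let $\mathbb{C}_1,\dots,\mathbb{C}_n$ and $\mathbb{D}$ be comonads on categories $\mathcal{C}_1,\dots,\mathcal{C}_n$ and $\mathcal{D}$ respectively, and let $H\colon \mathcal{C}_1\times\dots\times\mathcal{C}_n\to\mathcal{D}$ be a functor. Suppose that for every $A_1\in\mathcal{C}_1,\dots,A_n\in\mathcal{C}_n$ there exists a morphism $\kappa_{A_1,\dots,A_n}\colon \mathbb{D}(H(A_1,\dots,A_n))\to H(\mathbb{C}_1(A_1),\dots,\mathbb{C}_n(A_n))$ in $\mathcal{D}$. Then for all objects $A_i,B_i\in\mathcal{C}_i$ ($1\le i\le n$): if $A_i\rightarrow_{\mathbb{C}_i} B_i$ for all $i$, then $H(A_1,\dots,A_n)\rightarrow_{\mathbb{D}} H(B_1,\dots,B_n)$. The same holds with $\rightarrow$ replaced by $\rightleftarrows$ throughout.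
   Context: For a comonad $\mathbb{C}$ on a category $\mathcal{C}$ and objects $A,B$, write $A\rightarrow_{\mathbb{C}} B$ if there exists a morphism $\mathbb{C}(A)\to B$ in $\mathcal{C}$, and $A\rightleftarrows_{\mathbb{C}} B$ if both $A\rightarrow_{\mathbb{C}} B$ and $B\rightarrow_{\mathbb{C}} A$. No naturality of $\kappa$ is assumed. *)

theory Defs
  imports "HOL-Library.FuncSet"
begin

section \<open>Categories\<close>

text \<open>Composition is in the usual applicative order: \<open>Comp C g f\<close> is \<open>g\<close> after \<open>f\<close>. The values
  of the operations outside the carriers \<open>Ob C\<close> and \<open>Arr C\<close> are irrelevant.\<close>

record ('o, 'm) cat =
  Ob :: "'o set"
  Arr :: "'m set"
  Dom :: "'m \<Rightarrow> 'o"
  Cod :: "'m \<Rightarrow> 'o"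
  Ident :: "'o \<Rightarrow> 'm"
  Comp :: "'m \<Rightarrow> 'm \<Rightarrow> 'm"

definition hom :: "('o, 'm) cat \<Rightarrow> 'o \<Rightarrow> 'o \<Rightarrow> 'm set" where
  "hom C a b = {f \<in> Arr C. Dom C f = a \<and> Cod C f = b}"

locale category =
  fixes C :: "('o, 'm) cat"
  assumes Dom_closed: "f \<in> Arr C \<Longrightarrow> Dom C f \<in> Ob C"
    and Cod_closed: "f \<in> Arr C \<Longrightarrow> Cod C f \<in> Ob C"
    and Id_in_hom: "a \<in> Ob C \<Longrightarrow> Ident C a \<in> hom C a a"
    and Comp_in_hom: "f \<in> hom C a b \<Longrightarrow> g \<in> hom C b c \<Longrightarrow> Comp C g f \<in> hom C a c"
    and Comp_Id_right: "f \<in> hom C a b \<Longrightarrow> Comp C f (Ident C a) = f"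
    and Comp_Id_left: "f \<in> hom C a b \<Longrightarrow> Comp C (Ident C b) f = f"
    and Comp_assoc: "f \<in> hom C a b \<Longrightarrow> g \<in> hom C b c \<Longrightarrow> h \<in> hom C c d \<Longrightarrow>
      Comp C h (Comp C g f) = Comp C (Comp C h g) f"

text \<open>Tuples are extensional functions on the index set, so that equality of tuples of objects
  or of morphisms is componentwise equality.\<close>

definition product_cat :: "'i set \<Rightarrow> ('i \<Rightarrow> ('o, 'm) cat) \<Rightarrow> ('i \<Rightarrow> 'o, 'i \<Rightarrow> 'm) cat" where
  "product_cat I C =
    \<lparr>Ob = (\<Pi>\<^sub>E i\<in>I. Ob (C i)),
     Arr = (\<Pi>\<^sub>E i\<in>I. Arr (C i)),
     Dom = (\<lambda>f. \<lambda>i\<in>I. Dom (C i) (f i)),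
     Cod = (\<lambda>f. \<lambda>i\<in>I. Cod (C i) (f i)),
     Ident = (\<lambda>a. \<lambda>i\<in>I. Ident (C i) (a i)),
     Comp = (\<lambda>g f. \<lambda>i\<in>I. Comp (C i) (g i) (f i))\<rparr>"

lemma hom_product_cat:
  assumes "a \<in> Ob (product_cat I C)" "b \<in> Ob (product_cat I C)"
  shows "hom (product_cat I C) a b = (\<Pi>\<^sub>E i\<in>I. hom (C i) (a i) (b i))"
  using assms by (auto simp: product_cat_def hom_def PiE_iff fun_eq_iff extensional_def)

lemma hom_product_catD:
  assumes "f \<in> hom (product_cat I C) a b"
  shows "f \<in> extensional I" and "i \<in> I \<Longrightarrow> f i \<in> hom (C i) (a i) (b i)"
  using assms by (auto simp: product_cat_def hom_def PiE_iff)

lemma category_product_cat: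
  assumes "\<And>i. i \<in> I \<Longrightarrow> category (C i)"
  shows "category (product_cat I C)"
proof
  fix f assume "f \<in> Arr (product_cat I C)"
  then show "Dom (product_cat I C) f \<in> Ob (product_cat I C)"
    "Cod (product_cat I C) f \<in> Ob (product_cat I C)"
    using assms category.Dom_closed category.Cod_closed
    by (fastforce simp: product_cat_def)+
next
  fix a assume "a \<in> Ob (product_cat I C)"
  then show "Ident (product_cat I C) a \<in> hom (product_cat I C) a a"
    using category.Id_in_hom[OF assms]
    by (auto simp: hom_def product_cat_def PiE_iff fun_eq_iff extensional_def)
next
  fix f g a b c
  assume fg: "f \<in> hom (product_cat I C) a b" "g \<in> hom (product_cat I C) b c"
  have *: "Comp (C i) (g i) (f i) \<in> hom (C i) (a i) (c i)" if "i \<in> I" for i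
    using hom_product_catD(2)[OF fg(1) that] hom_product_catD(2)[OF fg(2) that]
      category.Comp_in_hom assms that by metis
  have "a \<in> extensional I" "c \<in> extensional I"
    using fg by (auto simp: hom_def product_cat_def)
  then show "Comp (product_cat I C) g f \<in> hom (product_cat I C) a c"
    using * by (auto simp: hom_def product_cat_def extensional_def)
next
  fix f a b assume f: "f \<in> hom (product_cat I C) a b"
  note f' = hom_product_catD[OF f]
  have "Comp (C i) (f i) (Ident (C i) (a i)) = f i"
    and "Comp (C i) (Ident (C i) (b i)) (f i) = f i" if "i \<in> I" for i
    using that f'(2) category.Comp_Id_right[OF assms] category.Comp_Id_left[OF assms] by blast+
  then show "Comp (product_cat I C) f (Ident (product_cat I C) a) = f"
    and "Comp (product_cat I C) (Ident (product_cat I C) b) f = f"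
    using f'(1) by (auto simp: product_cat_def fun_eq_iff extensional_def)
next
  fix f g h a b c d
  assume f: "f \<in> hom (product_cat I C) a b" and g: "g \<in> hom (product_cat I C) b c"
    and h: "h \<in> hom (product_cat I C) c d"
  have "Comp (C i) (h i) (Comp (C i) (g i) (f i)) = Comp (C i) (Comp (C i) (h i) (g i)) (f i)"
    if "i \<in> I" for i
    using that hom_product_catD(2)[OF f] hom_product_catD(2)[OF g] hom_product_catD(2)[OF h]
      category.Comp_assoc[OF assms] by blast
  then show "Comp (product_cat I C) h (Comp (product_cat I C) g f) =
      Comp (product_cat I C) (Comp (product_cat I C) h g) f"
    by (auto simp: product_cat_def fun_eq_iff)
qed

section \<open>Functors and natural transformations\<close>

record ('o, 'm, 'p, 'q) ftor =
  ob_map :: "'o \<Rightarrow> 'p"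
  arr_map :: "'m \<Rightarrow> 'q"

definition id_ftor :: "('o, 'm, 'o, 'm) ftor" where
  "id_ftor = \<lparr>ob_map = (\<lambda>a. a), arr_map = (\<lambda>f. f)\<rparr>"

definition comp_ftor ::
  "('p, 'q, 'r, 's) ftor \<Rightarrow> ('o, 'm, 'p, 'q) ftor \<Rightarrow> ('o, 'm, 'r, 's) ftor" where
  "comp_ftor G F =
    \<lparr>ob_map = (\<lambda>a. ob_map G (ob_map F a)), arr_map = (\<lambda>f. arr_map G (arr_map F f))\<rparr>"

locale cat_functor = source: category C + target: category D
  for C :: "('o, 'm) cat" and D :: "('p, 'q) cat" +
  fixes F :: "('o, 'm, 'p, 'q) ftor"
  assumes ob_map_closed: "a \<in> Ob C \<Longrightarrow> ob_map F a \<in> Ob D"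
    and arr_map_in_hom: "f \<in> hom C a b \<Longrightarrow> arr_map F f \<in> hom D (ob_map F a) (ob_map F b)"
    and arr_map_Id: "a \<in> Ob C \<Longrightarrow> arr_map F (Ident C a) = Ident D (ob_map F a)"
    and arr_map_Comp: "f \<in> hom C a b \<Longrightarrow> g \<in> hom C b c \<Longrightarrow>
      arr_map F (Comp C g f) = Comp D (arr_map F g) (arr_map F f)"

locale natural_transformation =
  source_functor: cat_functor C D F + target_functor: cat_functor C D G
  for C :: "('o, 'm) cat" and D :: "('p, 'q) cat"
    and F :: "('o, 'm, 'p, 'q) ftor" and G :: "('o, 'm, 'p, 'q) ftor" +
  fixes \<tau> :: "'o \<Rightarrow> 'q"
  assumes component_in_hom: "a \<in> Ob C \<Longrightarrow> \<tau> a \<in> hom D (ob_map F a) (ob_map G a)"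
    and naturality: "f \<in> hom C a b \<Longrightarrow>
      Comp D (\<tau> b) (arr_map F f) = Comp D (arr_map G f) (\<tau> a)"

section \<open>Comonads\<close>

record ('o, 'm) comonad_data =
  ftor_of :: "('o, 'm, 'o, 'm) ftor"
  counit :: "'o \<Rightarrow> 'm"
  comult :: "'o \<Rightarrow> 'm"

locale comonad =
  counit: natural_transformation C C "ftor_of W" id_ftor "counit W" +
  comult: natural_transformation C C "ftor_of W" "comp_ftor (ftor_of W) (ftor_of W)" "comult W"
  for C :: "('o, 'm) cat" and W :: "('o, 'm) comonad_data" +
  assumes counit_left: "a \<in> Ob C \<Longrightarrow>
      Comp C (counit W (ob_map (ftor_of W) a)) (comult W a) = Ident C (ob_map (ftor_of W) a)"
    and counit_right: "a \<in> Ob C \<Longrightarrow>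
      Comp C (arr_map (ftor_of W) (counit W a)) (comult W a) = Ident C (ob_map (ftor_of W) a)"
    and coassoc: "a \<in> Ob C \<Longrightarrow>
      Comp C (comult W (ob_map (ftor_of W) a)) (comult W a) =
      Comp C (arr_map (ftor_of W) (comult W a)) (comult W a)"

abbreviation comonad_ob :: "('o, 'm) comonad_data \<Rightarrow> 'o \<Rightarrow> 'o" where
  "comonad_ob W \<equiv> ob_map (ftor_of W)"

definition comonad_arrow :: "('o, 'm) cat \<Rightarrow> ('o, 'm) comonad_data \<Rightarrow> 'o \<Rightarrow> 'o \<Rightarrow> bool" where
  "comonad_arrow C W a b \<longleftrightarrow> (\<exists>f. f \<in> hom C (comonad_ob W a) b)"

definition comonad_biarrow :: "('o, 'm) cat \<Rightarrow> ('o, 'm) comonad_data \<Rightarrow> 'o \<Rightarrow> 'o \<Rightarrow> bool" where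
  "comonad_biarrow C W a b \<longleftrightarrow> comonad_arrow C W a b \<and> comonad_arrow C W b a"

end

theory Submission imports Defs begin

text \<open>Morphisms \<open>f i : W i (A i) \<rightarrow> B i\<close> form a single morphism of the product category. Its image
  under \<open>H\<close>, precomposed with \<open>\<kappa>\<close> at \<open>A\<close>, is a morphism \<open>V (H A) \<rightarrow> H B\<close>.\<close>

lemma comonad_ob_closed:
  assumes "comonad C W" "a \<in> Ob C"
  shows "comonad_ob W a \<in> Ob C"
proof -
  interpret comonad C W by fact
  show ?thesis using assms(2) by (rule counit.source_functor.ob_map_closed)
qed

text \<open>One direction for a fixed pair \<open>A\<close>, \<open>B\<close>, using just the
  component of \<kappa> at \<open>A\<close>. The two-way version comes from applying it a second
  time with the tuples exchanged and the component at \<open>B\<close>.\<close>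

lemma comonad_arrow_functor:
  assumes comonads: "\<And>i. i \<in> I \<Longrightarrow> comonad (C i) (W i)"
    and "cat_functor (product_cat I C) D H"
    and A: "A \<in> (\<Pi>\<^sub>E i\<in>I. Ob (C i))" and B: "B \<in> (\<Pi>\<^sub>E i\<in>I. Ob (C i))"
    and \<kappa>: "\<kappa> \<in> hom D (comonad_ob V (ob_map H A)) (ob_map H (\<lambda>i\<in>I. comonad_ob (W i) (A i)))"
    and arrows: "\<And>i. i \<in> I \<Longrightarrow> comonad_arrow (C i) (W i) (A i) (B i)"
  shows "comonad_arrow D V (ob_map H A) (ob_map H B)"
proof -
  interpret H: cat_functor "product_cat I C" D H by fact
  \<comment> \<open>This tuple is where \<kappa> and the image under \<open>H\<close> meet. Both it
    and \<open>B\<close> must be shown to be objects, since \<open>hom_product_cat\<close> computes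
    hom-sets as products only between objects.\<close>
  define WA where "WA = (\<lambda>i\<in>I. comonad_ob (W i) (A i))"
  have "WA \<in> Ob (product_cat I C)"
    using A comonad_ob_closed[OF comonads] by (auto simp: WA_def product_cat_def PiE_iff)
  moreover have "B \<in> Ob (product_cat I C)"
    using B by (simp add: product_cat_def)
  moreover obtain f where "\<And>i. i \<in> I \<Longrightarrow> f i \<in> hom (C i) (comonad_ob (W i) (A i)) (B i)"
    using arrows unfolding comonad_arrow_def by metis
  \<comment> \<open>The chosen family \<open>f\<close> is arbitrary outside \<open>I\<close>;
    restricting it makes it extensional, as arrows of the product category must be.\<close>
  then have "(\<lambda>i\<in>I. f i) \<in> (\<Pi>\<^sub>E i\<in>I. hom (C i) (WA i) (B i))"
    by (simp add: WA_def)
  ultimately have "(\<lambda>i\<in>I. f i) \<in> hom (product_cat I C) WA B"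
    by (simp add: hom_product_cat)
  then have "arr_map H (\<lambda>i\<in>I. f i) \<in> hom D (ob_map H WA) (ob_map H B)"
    by (rule H.arr_map_in_hom)
  \<comment> \<open>The witness is
    \<open>Comp D (arr_map H (\<lambda>i\<in>I. f i)) \<kappa>\<close>.\<close>
  with \<kappa> show ?thesis
    unfolding comonad_arrow_def WA_def by (blast intro: H.target.Comp_in_hom)
qed

theorem theorem2:
  fixes n :: nat
    and C :: "nat \<Rightarrow> ('o, 'm) cat" and W :: "nat \<Rightarrow> ('o, 'm) comonad_data"
    and D :: "('p, 'q) cat" and V :: "('p, 'q) comonad_data"
    and H :: "(nat \<Rightarrow> 'o, nat \<Rightarrow> 'm, 'p, 'q) ftor"
  assumes "\<And>i. i \<in> {1..n} \<Longrightarrow> comonad (C i) (W i)"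
    and "comonad D V"
    and "cat_functor (product_cat {1..n} C) D H"
    and "\<And>A. A \<in> (\<Pi>\<^sub>E i\<in>{1..n}. Ob (C i)) \<Longrightarrow>
      \<exists>\<kappa>. \<kappa> \<in> hom D (comonad_ob V (ob_map H A)) (ob_map H (\<lambda>i\<in>{1..n}. comonad_ob (W i) (A i)))"
  shows "\<forall>A \<in> (\<Pi>\<^sub>E i\<in>{1..n}. Ob (C i)). \<forall>B \<in> (\<Pi>\<^sub>E i\<in>{1..n}. Ob (C i)).
    ((\<forall>i\<in>{1..n}. comonad_arrow (C i) (W i) (A i) (B i)) \<longrightarrow>
      comonad_arrow D V (ob_map H A) (ob_map H B)) \<and>
    ((\<forall>i\<in>{1..n}. comonad_biarrow (C i) (W i) (A i) (B i)) \<longrightarrow>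
      comonad_biarrow D V (ob_map H A) (ob_map H B))"
proof -
  \<comment> \<open>Proved for all \<open>A\<close> and \<open>B\<close>, so that the biarrow claim
    can use it for both (\<open>A\<close>, \<open>B\<close>) and (\<open>B\<close>,
    \<open>A\<close>).\<close>
  have "comonad_arrow D V (ob_map H A) (ob_map H B)"
    if "A \<in> (\<Pi>\<^sub>E i\<in>{1..n}. Ob (C i))" "B \<in> (\<Pi>\<^sub>E i\<in>{1..n}. Ob (C i))"
      "\<forall>i\<in>{1..n}. comonad_arrow (C i) (W i) (A i) (B i)" for A B
    using assms(4)[OF that(1)] comonad_arrow_functor[OF assms(1,3) that(1,2)] that(3) by blast
  then show ?thesis
    unfolding comonad_biarrow_def by blast
qed

end
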